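(* Let $\alpha \in (0, \pi/2]$ and let $T \in M_2$ be nonzero with $W(T) \subseteq S(\alpha)$. Then $$\|T\| \le w(T) \sqrt{1+\sin^2\alpha}.$$ Equality holds if and only if $T/\|T\|$ is unitarily similar to the matrix $$\frac{1}{1+2s} \begin{pmatrix} \sqrt{1+s-s^2} + i \sqrt{s+s^2} & 2s \\ 0 & \sqrt{1+s-s^2}-i \sqrt{s+s^2} \end{pmatrix}, \qquad s = \sin^2\alpha.$$
   Context: $M_2$ is the set of $2\times 2$ complex matrices, and $\|\cdot\|$ is the operator (spectral) norm. For $T\in M_2$, the numerical range is $W(T)=\{\langle Tx,x\rangle : x\in\mathbb{C}^2, \|x\|=1\}$ and the numerical radius is $w(T)=\sup\{|\mu|:\mu\in W(T)\}$. For $\alpha\in(0,\pi/2)$, $S(\alpha)=\{a+ib : a,b\in\mathbb{R},\ |b|\le a\tan\alpha\}$; $S(\pi/2)$ is the closed right half-plane $\{a+ib: a,b\in\mathbb{R},\ a\ge 0\}$, so that $W(T)\subseteq S(\pi/2)$ means that $T+T^*$ is positive semidefinite. *)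

theory Defs
  imports "HOL-Analysis.Analysis"
begin

text \<open>The library's \<open>inner\<close> on \<open>complex ^ 'n\<close> is the real inner product; this is the
  Hermitian one, linear in the first argument. It induces the library \<open>norm\<close>.\<close>
definition hinner :: "complex ^ 'n \<Rightarrow> complex ^ 'n \<Rightarrow> complex" where
  "hinner x y = (\<Sum>i\<in>UNIV. x $ i * cnj (y $ i))"

definition numerical_range :: "complex ^ 'n ^ 'n \<Rightarrow> complex set" where
  "numerical_range T = {hinner (T *v x) x | x. norm x = 1}"

definition numerical_radius :: "complex ^ 'n ^ 'n \<Rightarrow> real" where
  "numerical_radius T = (SUP \<mu>\<in>numerical_range T. cmod \<mu>)"

definition op_norm :: "complex ^ 'n ^ 'n \<Rightarrow> real" where
  "op_norm T = onorm (\<lambda>x. T *v x)"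

text \<open>The case \<open>\<alpha> = pi / 2\<close> is separate because \<open>tan (pi / 2) = 0\<close> in HOL.\<close>
definition sector :: "real \<Rightarrow> complex set" where
  "sector \<alpha> = (if \<alpha> = pi / 2 then {z. Re z \<ge> 0}
                else {z. \<bar>Im z\<bar> \<le> Re z * tan \<alpha>})"

definition conj_transpose :: "complex ^ 'n ^ 'm \<Rightarrow> complex ^ 'm ^ 'n" where
  "conj_transpose A = (\<chi> i j. cnj (A $ j $ i))"

definition unitary_matrix :: "complex ^ 'n ^ 'n \<Rightarrow> bool" where
  "unitary_matrix U \<longleftrightarrow> conj_transpose U ** U = mat 1 \<and> U ** conj_transpose U = mat 1"

definition unitarily_similar :: "complex ^ 'n ^ 'n \<Rightarrow> complex ^ 'n ^ 'n \<Rightarrow> bool" where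
  "unitarily_similar A B \<longleftrightarrow> (\<exists>U. unitary_matrix U \<and> A = conj_transpose U ** B ** U)"

definition extremal_matrix :: "real \<Rightarrow> complex ^ 2 ^ 2" where
  "extremal_matrix s = (1 / (1 + 2 * s)) *\<^sub>R
     vector [vector [Complex (sqrt (1 + s - s\<^sup>2)) (sqrt (s + s\<^sup>2)), complex_of_real (2 * s)],
             vector [0, Complex (sqrt (1 + s - s\<^sup>2)) (- sqrt (s + s\<^sup>2))]]"

end

theory Submission
  imports Defs
begin

text \<open>Three unitary invariants carry the proof: the trace, the determinant and the Frobenius norm of \<open>T\<close>.
  After division by the operator norm, \<open>1 - T* T\<close> is a singular positive matrix, so the squared Frobenius norm is
  \<open>1 + t\<^sup>2\<close> with \<open>t = cmod (det T)\<close> (\<open>frobenius_sq_of_op_norm_1\<close>).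

  A half-plane \<open>Re (w * z) \<le> r\<close> contains the numerical range if and only if \<open>r - Re (w T)\<close> is positive
  semidefinite, and nonnegativity of its determinant is an inequality in these invariants
  (\<open>supporting_halfplane_determinant\<close>). It is applied to the half-planes that contain the sector,
  and to those that contain the disc of radius \<open>r\<close>, the numerical radius. In both cases a whole range of directions
  \<open>w\<close> is available, and by \<open>small_rotation_lowers_Re\<close> some direction in the range does at least
  as well as if the determinant were positive and, for the disc, the trace as well. With \<open>q = cmod (trace T)\<close> and
  \<open>s = (sin \<alpha>)\<^sup>2\<close> the sector gives \<open>q\<^sup>2 \<ge> (1 + t)\<^sup>2 - 4 * t * s\<close>, and the disc gives
  \<open>4 * r\<^sup>2 - 4 * r * q * k + q\<^sup>2 + 2 * t * (2 * k\<^sup>2 - 1) - (1 + t\<^sup>2) \<ge> 0\<close> for all \<open>k\<close> in the unit interval.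

  Suppose \<open>r \<le> W\<close>, where \<open>W\<^sup>2 * (1 + s) = 1\<close>. Then the disc inequality also holds with \<open>W\<close> for \<open>r\<close>, and minimising
  its left side over \<open>k\<close> produces a perfect square that cannot be positive (\<open>extremal_parameters\<close>). Hence \<open>r = W\<close>,
  both inequalities are equalities, and \<open>q\<close> and \<open>t\<close> are determined by \<open>s\<close>. Since the rotation lemma is strict
  for an argument out of place, trace and determinant are positive real numbers
  (\<open>extremal_case\<close>). The three invariants are now those of the extremal matrix, and by
  Schur triangularisation they determine a \<open>2 \<times> 2\<close> matrix up to unitary similarity
  (\<open>unitarily_similar_extremal\<close>). Conversely, the numerical range of the extremal matrix is an
  ellipse inside the disc of radius \<open>W\<close> (\<open>numerical_range_extremal\<close>).\<close>

section \<open>Invariants and positive Hermitian forms\<close>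

lemma norm_sq_2: "(norm (x :: complex ^ 2))\<^sup>2 = (cmod (x$1))\<^sup>2 + (cmod (x$2))\<^sup>2"
  by (simp add: norm_vec_def L2_set_def UNIV_2)

lemma hinner_2: "hinner (T *v x) x = T$1$1 * (x$1 * cnj (x$1)) + T$1$2 * (x$2 * cnj (x$1))
   + T$2$1 * (x$1 * cnj (x$2)) + T$2$2 * (x$2 * cnj (x$2))" for T :: "complex^2^2"
  by (simp add: hinner_def matrix_vector_mult_def UNIV_2 algebra_simps)

definition frobenius_sq :: "complex ^ 2 ^ 2 \<Rightarrow> real" where
  "frobenius_sq T = (\<Sum>i\<in>UNIV. \<Sum>j\<in>UNIV. (cmod (T $ i $ j))\<^sup>2)"

lemma frobenius_sq_2: "frobenius_sq T = (cmod (T$1$1))\<^sup>2 + (cmod (T$1$2))\<^sup>2 + (cmod (T$2$1))\<^sup>2 + (cmod (T$2$2))\<^sup>2"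
  by (simp add: frobenius_sq_def UNIV_2)

lemma trace_2: "trace (T :: complex^2^2) = T$1$1 + T$2$2"
  by (simp add: trace_def UNIV_2)

text \<open>The form is \<open>u\<close> times a square plus a multiple of \<open>4 * p * u - (cmod g)\<^sup>2\<close>; the vector
  \<open>(2 * u, cnj g)\<close> kills the square. If \<open>u = 0\<close>, the form is unbounded below along
  \<open>(1, N * cnj g)\<close> unless \<open>g = 0\<close>.\<close>
lemma hermitian_form_nonneg:
  fixes p u :: real and g :: complex
  assumes "\<And>x y. p * (cmod x)\<^sup>2 + u * (cmod y)\<^sup>2 - Re (g * (y * cnj x)) \<ge> 0"
  shows "(cmod g)\<^sup>2 \<le> 4 * p * u"
proof (cases "u = 0")
  case True
  have "g = 0"
  proof (rule ccontr)
    assume "g \<noteq> 0"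
    \<comment> \<open>Any \<open>N > p / (cmod g)\<^sup>2\<close> contradicts nonnegativity.\<close>
    define N where "N = (p + 1) / (cmod g)\<^sup>2"
    have "p - N * (cmod g)\<^sup>2 \<ge> 0"
      using assms[of 1 "N *\<^sub>R cnj g"] True unfolding cmod_power2
      by (simp add: power2_eq_square algebra_simps)
    with \<open>g \<noteq> 0\<close> show False by (simp add: N_def)
  qed
  with True show ?thesis by simp
next
  case False
  have "u \<ge> 0" using assms[of 0 1] by simp
  have "p * (2 * u)\<^sup>2 + u * (cmod g)\<^sup>2 - 2 * u * (cmod g)\<^sup>2 \<ge> 0"
    using assms[of "of_real (2*u)" "cnj g"] \<open>u \<ge> 0\<close> unfolding cmod_power2
    by (simp add: power2_eq_square algebra_simps)
  then have "u * (4 * p * u - (cmod g)\<^sup>2) \<ge> 0"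
    by (simp add: power2_eq_square algebra_simps)
  with False \<open>u \<ge> 0\<close> show ?thesis by (simp add: zero_le_mult_iff)
qed

lemma hinner_scaleR: "hinner (T *v (k *\<^sub>R x)) (k *\<^sub>R x) = k\<^sup>2 *\<^sub>R hinner (T *v x) x"
  for T :: "complex^2^2"
  by (simp add: hinner_2) (simp add: scaleR_conv_of_real power2_eq_square algebra_simps)

lemma quadratic_form_bound:
  fixes T :: "complex^2^2"
  assumes "\<And>x. norm x = 1 \<Longrightarrow> Re (w * hinner (T *v x) x) \<le> r"
  shows "Re (w * hinner (T *v x) x) \<le> r * (norm x)\<^sup>2"
proof (cases "x = 0")
  case True
  then show ?thesis by (simp add: hinner_def)
next
  case False
  define y where "y = (1 / norm x) *\<^sub>R x"
  have x: "norm x *\<^sub>R y = x" and "norm y = 1" using False by (simp_all add: y_def)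
  have "hinner (T *v x) x = (norm x)\<^sup>2 *\<^sub>R hinner (T *v y) y"
    using hinner_scaleR[of T "norm x" y] by (simp add: x)
  then have "Re (w * hinner (T *v x) x) = (norm x)\<^sup>2 * Re (w * hinner (T *v y) y)"
    by simp
  also have "\<dots> \<le> (norm x)\<^sup>2 * r"
    using assms[OF \<open>norm y = 1\<close>] by (intro mult_left_mono) auto
  finally show ?thesis by (simp add: mult.commute)
qed

text \<open>The numerical range lies in the half-plane \<open>Re (w * z) \<le> r\<close> exactly when the Hermitian
  matrix \<open>r - Re (w T)\<close> is positive semidefinite. The expression below is four times its
  determinant, written in the unitary invariants of \<open>T\<close>.\<close>
lemma supporting_halfplane_determinant:
  fixes T :: "complex^2^2"
  assumes "cmod w = 1" and r: "\<And>z. z \<in> numerical_range T \<Longrightarrow> Re (w * z) \<le> r"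
  shows "4 * r\<^sup>2 - 4 * r * Re (w * trace T) + (cmod (trace T))\<^sup>2 + 2 * Re (w\<^sup>2 * det T)
     - frobenius_sq T \<ge> 0"
proof -
  define a b c d where "a = T$1$1" "b = T$1$2" "c = T$2$1" "d = T$2$2"
  define g where "g = w * b + cnj w * cnj c"
  have "(cmod g)\<^sup>2 \<le> 4 * (r - Re (w * a)) * (r - Re (w * d))"
  proof (rule hermitian_form_nonneg)
    fix x y
    have "Re (w * hinner (T *v vector [x, y]) (vector [x, y])) \<le> r * (norm (vector [x, y] :: complex^2))\<^sup>2"
      by (rule quadratic_form_bound) (use r in \<open>auto simp: numerical_range_def\<close>)
    then have "Re (w * (a * (x * cnj x) + b * (y * cnj x) + c * (x * cnj y) + d * (y * cnj y)))
       \<le> r * ((cmod x)\<^sup>2 + (cmod y)\<^sup>2)"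
      by (simp add: hinner_2 norm_sq_2 a_b_c_d_def)
    moreover have "Re (w * (a * (x * cnj x) + b * (y * cnj x) + c * (x * cnj y) + d * (y * cnj y)))
       = Re (w * a) * (cmod x)\<^sup>2 + Re (w * d) * (cmod y)\<^sup>2 + Re (g * (y * cnj x))"
      unfolding g_def cmod_power2 by (simp add: power2_eq_square algebra_simps)
    ultimately show "0 \<le> (r - Re (w * a)) * (cmod x)\<^sup>2 + (r - Re (w * d)) * (cmod y)\<^sup>2 - Re (g * (y * cnj x))"
      by (simp add: algebra_simps)
  qed
  moreover have "(cmod g)\<^sup>2 = (cmod w)\<^sup>2 * ((cmod b)\<^sup>2 + (cmod c)\<^sup>2) + 2 * Re (w\<^sup>2 * (b * c))"
    unfolding g_def cmod_power2 by (simp add: power2_eq_square algebra_simps)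
  moreover have "4 * Re (w * a) * Re (w * d) = 2 * Re (w\<^sup>2 * (a * d))
      + (cmod w)\<^sup>2 * ((cmod (a + d))\<^sup>2 - (cmod a)\<^sup>2 - (cmod d)\<^sup>2)"
    unfolding cmod_power2 by (simp add: power2_eq_square algebra_simps)
  moreover have "4 * (r - Re (w * a)) * (r - Re (w * d))
      = 4 * r\<^sup>2 - 4 * r * Re (w * (a + d)) + 4 * Re (w * a) * Re (w * d)"
    by (simp only: distrib_left plus_complex.sel) algebra
  moreover have "Re (w\<^sup>2 * (a * d - b * c)) = Re (w\<^sup>2 * (a * d)) - Re (w\<^sup>2 * (b * c))"
    by (simp only: right_diff_distrib minus_complex.sel)
  moreover have "trace T = a + d" "det T = a * d - b * c"
      "frobenius_sq T = (cmod a)\<^sup>2 + (cmod b)\<^sup>2 + (cmod c)\<^sup>2 + (cmod d)\<^sup>2"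
    by (simp_all add: trace_2 det_2 frobenius_sq_2 a_b_c_d_def)
  ultimately show ?thesis
    using \<open>cmod w = 1\<close> by simp
qed

section \<open>Eliminating the arguments of trace and determinant\<close>

text \<open>Rotating \<open>D\<close> through \<open>2 * \<psi>\<close> with \<open>\<bar>\<psi>\<bar> \<le> \<eta>\<close> can always bring its argument to an angle of
  modulus between \<open>2 * \<eta>\<close> and \<open>pi\<close>, by rotating away from the positive axis and stopping at the
  negative one. Thus a bound that holds for all these rotations may be used as if \<open>D\<close> were
  positive and rotated through the full angle \<open>2 * \<eta>\<close>. This removes the arguments of trace and determinant
  from the problem; the strict version recovers them in the case of equality.\<close>
lemma small_rotation_lowers_Re:
  fixes D :: complex
  assumes "0 \<le> \<eta>" "\<eta> \<le> pi/2"
  obtains \<psi> where "\<bar>\<psi>\<bar> \<le> \<eta>" "Re (cis (2 * \<psi>) * D) \<le> cmod D * cos (2 * \<eta>)"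
    "\<eta> < pi/2 \<Longrightarrow> D \<noteq> of_real (cmod D) \<Longrightarrow> Re (cis (2 * \<psi>) * D) < cmod D * cos (2 * \<eta>)"
proof -
  define \<beta> where "\<beta> = Arg D / 2"
  \<comment> \<open>The rotation goes in the direction of the sign of \<open>\<beta>\<close> and is capped where \<open>\<bar>\<psi>\<bar> + \<bar>\<beta>\<bar> = pi/2\<close>.\<close>
  define \<psi> where "\<psi> = (if \<beta> \<ge> 0 then 1 else -1) * min \<eta> (pi/2 - \<bar>\<beta>\<bar>)"
  have D: "D = of_real (cmod D) * cis (2 * \<beta>)"
    using rcis_cmod_Arg[of D] by (simp add: \<beta>_def rcis_def)
  have \<beta>: "\<bar>\<beta>\<bar> \<le> pi/2" unfolding \<beta>_def using Arg_bounded[of D] by linarith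
  have Re: "Re (cis (2 * \<psi>) * D) = cmod D * cos (2 * (\<bar>\<psi>\<bar> + \<bar>\<beta>\<bar>))"
  proof -
    have "cis (2 * \<psi>) * D = of_real (cmod D) * cis (2 * (\<psi> + \<beta>))"
      by (subst D) (simp add: cis_mult algebra_simps)
    moreover have "\<bar>\<psi>\<bar> + \<bar>\<beta>\<bar> = \<bar>\<psi> + \<beta>\<bar>"
    proof (cases "\<beta> \<ge> 0")
      case True
      then have "0 \<le> \<psi>" using assms \<beta> by (simp add: \<psi>_def)
      with True show ?thesis by simp
    next
      case False
      then have "\<psi> \<le> 0" using assms \<beta> by (simp add: \<psi>_def)
      with False show ?thesis by simp
    qed
    moreover have "cos (2 * \<bar>\<psi> + \<beta>\<bar>) = cos (2 * (\<psi> + \<beta>))"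
      by (metis abs_mult abs_numeral cos_abs_real)
    ultimately show ?thesis by simp
  qed
  have abs: "\<bar>\<psi>\<bar> = min \<eta> (pi/2 - \<bar>\<beta>\<bar>)" using assms \<beta> by (auto simp: \<psi>_def min_def)
  show thesis
  proof
    show "\<bar>\<psi>\<bar> \<le> \<eta>" using abs by simp
    show "Re (cis (2 * \<psi>) * D) \<le> cmod D * cos (2 * \<eta>)"
      unfolding Re by (intro mult_left_mono cos_monotone_0_pi_le) (use abs assms \<beta> in \<open>auto simp: min_def\<close>)
    assume "\<eta> < pi/2" "D \<noteq> of_real (cmod D)"
    then have "\<beta> \<noteq> 0" "D \<noteq> 0" using D by auto
    with \<open>\<eta> < pi/2\<close> show "Re (cis (2 * \<psi>) * D) < cmod D * cos (2 * \<eta>)"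
      unfolding Re by (intro mult_strict_left_mono cos_monotone_0_pi) (use abs assms \<beta> in \<open>auto simp: min_def\<close>)
  qed
qed

text \<open>The sector is the intersection of the half-planes through \<open>0\<close> whose inner normals make an angle of at most
  \<open>pi/2 - \<alpha>\<close> with the positive real axis.\<close>
lemma rotated_sector_nonneg:
  assumes \<alpha>: "0 < \<alpha>" "\<alpha> \<le> pi/2" and z: "z \<in> sector \<alpha>" and \<theta>: "\<bar>\<theta>\<bar> \<le> pi/2 - \<alpha>"
  shows "0 \<le> Re (cis \<theta> * z)"
proof (cases "\<alpha> = pi/2")
  case True
  with z \<theta> show ?thesis by (simp add: sector_def)
next
  case False
  then have "\<alpha> < pi/2" using \<alpha> by simp
  then have "0 < tan \<alpha>" "0 < cos \<alpha>" "0 < sin \<alpha>" using \<alpha> by (auto intro: tan_gt_zero cos_gt_zero sin_gt_zero)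
  have Im: "\<bar>Im z\<bar> \<le> Re z * tan \<alpha>" using z False by (simp add: sector_def)
  then have "0 \<le> Re z" using \<open>0 < tan \<alpha>\<close>
    by (meson abs_ge_zero order_trans zero_le_mult_iff not_less)
  have "cos (pi/2 - \<alpha>) \<le> cos \<bar>\<theta>\<bar>"
    using \<alpha> \<theta> by (intro cos_monotone_0_pi_le) auto
  then have cos: "sin \<alpha> \<le> cos \<theta>" by (simp add: cos_diff)
  have "sin \<bar>\<theta>\<bar> \<le> sin (pi/2 - \<alpha>)"
    using \<alpha> \<theta> by (intro sin_monotone_2pi_le) auto
  moreover have "\<bar>sin \<theta>\<bar> = sin \<bar>\<theta>\<bar>"
    using \<alpha> \<theta> sin_ge_zero[of "\<bar>\<theta>\<bar>"] by (auto simp: abs_if split: if_splits)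
  ultimately have sin: "\<bar>sin \<theta>\<bar> \<le> cos \<alpha>" by (simp add: sin_diff)
  have "\<bar>sin \<theta> * Im z\<bar> \<le> cos \<alpha> * (Re z * tan \<alpha>)"
    unfolding abs_mult using Im sin \<open>0 < cos \<alpha>\<close> by (intro mult_mono) auto
  also have "\<dots> = sin \<alpha> * Re z" using \<open>0 < cos \<alpha>\<close> by (simp add: tan_def)
  also have "\<dots> \<le> cos \<theta> * Re z" using cos \<open>0 \<le> Re z\<close> by (intro mult_right_mono) auto
  finally show ?thesis by simp
qed

text \<open>The supporting half-planes of the sector all pass through \<open>0\<close>, so only the quadratic terms of
  \<open>supporting_halfplane_determinant\<close> survive, and the inclination of the half-plane can be
  chosen as in \<open>small_rotation_lowers_Re\<close> with \<open>\<eta> = pi/2 - \<alpha>\<close>.\<close>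
lemma sector_bounds_trace:
  fixes T :: "complex^2^2"
  assumes \<alpha>: "0 < \<alpha>" "\<alpha> \<le> pi/2" and T: "numerical_range T \<subseteq> sector \<alpha>"
  defines "\<Delta> \<equiv> (cmod (trace T))\<^sup>2 + 2 * cmod (det T) * (2 * (sin \<alpha>)\<^sup>2 - 1) - frobenius_sq T"
  shows "0 \<le> \<Delta>" and "det T \<noteq> of_real (cmod (det T)) \<Longrightarrow> 0 < \<Delta>"
proof -
  obtain \<psi> where \<psi>: "\<bar>\<psi>\<bar> \<le> pi/2 - \<alpha>"
      "Re (cis (2 * \<psi>) * det T) \<le> cmod (det T) * cos (2 * (pi/2 - \<alpha>))"
      "det T \<noteq> of_real (cmod (det T)) \<Longrightarrow>
        Re (cis (2 * \<psi>) * det T) < cmod (det T) * cos (2 * (pi/2 - \<alpha>))"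
    using \<alpha> by (rule_tac small_rotation_lowers_Re[of "pi/2 - \<alpha>" "det T"]) auto
  have cos: "cos (2 * (pi/2 - \<alpha>)) = 2 * (sin \<alpha>)\<^sup>2 - 1"
    by (simp add: right_diff_distrib cos_diff cos_double_sin)
  have "0 \<le> 4 * 0\<^sup>2 - 4 * 0 * Re (- cis \<psi> * trace T) + (cmod (trace T))\<^sup>2
      + 2 * Re ((- cis \<psi>)\<^sup>2 * det T) - frobenius_sq T"
    using rotated_sector_nonneg[OF \<alpha> _ \<psi>(1)] T
    by (intro supporting_halfplane_determinant) auto
  moreover have "(- cis \<psi>)\<^sup>2 = cis (2 * \<psi>)" by (simp add: power2_eq_square cis_mult)
  ultimately have nonneg: "0 \<le> (cmod (trace T))\<^sup>2 + 2 * Re (cis (2 * \<psi>) * det T) - frobenius_sq T"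
    by simp
  from nonneg \<psi>(2) show "0 \<le> \<Delta>" unfolding \<Delta>_def cos by linarith
  assume "det T \<noteq> of_real (cmod (det T))"
  from nonneg \<psi>(3)[OF this] show "0 < \<Delta>" unfolding \<Delta>_def cos by linarith
qed

text \<open>Here the half-planes support the disc of radius \<open>r\<close>, in directions within \<open>\<eta> = arccos k\<close> of
  the conjugate \<open>u\<close> of the direction of the trace. Turning away from \<open>u\<close> by at most \<open>\<eta>\<close> costs at
  most the factor \<open>k\<close> in the linear term.\<close>
lemma disc_bounds_trace:
  fixes T :: "complex^2^2"
  assumes r: "\<And>z. z \<in> numerical_range T \<Longrightarrow> cmod z \<le> r" and "0 \<le> r"
    and u: "cmod u = 1" "u * trace T = of_real (cmod (trace T))" and k: "0 \<le> k" "k \<le> 1"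
  defines "\<Delta> \<equiv> 4 * r\<^sup>2 - 4 * r * cmod (trace T) * k + (cmod (trace T))\<^sup>2
      + 2 * cmod (det T) * (2 * k\<^sup>2 - 1) - frobenius_sq T"
  shows "0 \<le> \<Delta>" and "0 < k \<Longrightarrow> u\<^sup>2 * det T \<noteq> of_real (cmod (det T)) \<Longrightarrow> 0 < \<Delta>"
proof -
  define D where "D = u\<^sup>2 * det T"
  have cmod_D: "cmod D = cmod (det T)" using u by (simp add: D_def norm_mult norm_power)
  define \<eta> where "\<eta> = arccos k"
  have \<eta>: "0 \<le> \<eta>" "\<eta> \<le> pi/2" "cos \<eta> = k" using k arccos_le_pi2[of k] by (auto simp: \<eta>_def arccos_lbound)
  have \<eta>_less: "\<eta> < pi/2" if "0 < k"
    using that \<eta> by (metis cos_pi_half less_eq_real_def less_irrefl)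
  obtain \<psi> where \<psi>: "\<bar>\<psi>\<bar> \<le> \<eta>" "Re (cis (2 * \<psi>) * D) \<le> cmod D * cos (2 * \<eta>)"
    "\<eta> < pi/2 \<Longrightarrow> D \<noteq> of_real (cmod D) \<Longrightarrow> Re (cis (2 * \<psi>) * D) < cmod D * cos (2 * \<eta>)"
    using small_rotation_lowers_Re[OF \<eta>(1,2)] by blast
  have cos: "cos (2 * \<eta>) = 2 * k\<^sup>2 - 1" by (simp add: cos_double_cos \<eta>)
  have "cos \<eta> \<le> cos \<bar>\<psi>\<bar>" using \<eta> \<psi> by (intro cos_monotone_0_pi_le) auto
  then have "4 * r * cmod (trace T) * k \<le> 4 * r * cmod (trace T) * cos \<psi>"
    using \<open>0 \<le> r\<close> \<eta> by (intro mult_left_mono) auto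
  moreover have "0 \<le> 4 * r\<^sup>2 - 4 * r * Re (cis \<psi> * u * trace T) + (cmod (trace T))\<^sup>2
      + 2 * Re ((cis \<psi> * u)\<^sup>2 * det T) - frobenius_sq T"
  proof (rule supporting_halfplane_determinant)
    show "cmod (cis \<psi> * u) = 1" using u by (simp add: norm_mult)
    fix z assume "z \<in> numerical_range T"
    have "Re (cis \<psi> * u * z) \<le> cmod (cis \<psi> * u * z)" by (rule complex_Re_le_cmod)
    also have "\<dots> \<le> r" using r[OF \<open>z \<in> _\<close>] u by (simp add: norm_mult)
    finally show "Re (cis \<psi> * u * z) \<le> r" .
  qed
  moreover have "(cis \<psi> * u)\<^sup>2 * det T = cis (2 * \<psi>) * D"
    by (simp add: D_def power_mult_distrib) (simp add: power2_eq_square cis_mult mult.commute)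
  moreover have "Re (cis \<psi> * u * trace T) = cmod (trace T) * cos \<psi>"
    by (simp add: mult.assoc u)
  ultimately have nonneg: "0 \<le> 4 * r\<^sup>2 - 4 * r * cmod (trace T) * k + (cmod (trace T))\<^sup>2
      + 2 * Re (cis (2 * \<psi>) * D) - frobenius_sq T"
    by (simp only: mult.assoc)
  from nonneg \<psi>(2) show "0 \<le> \<Delta>" unfolding \<Delta>_def cos cmod_D by linarith
  assume "0 < k" "u\<^sup>2 * det T \<noteq> of_real (cmod (det T))"
  then have "Re (cis (2 * \<psi>) * D) < cmod (det T) * (2 * k\<^sup>2 - 1)"
    using \<psi>(3) \<eta>_less cmod_D cos by (simp add: D_def)
  with nonneg show "0 < \<Delta>" unfolding \<Delta>_def by linarith
qed

section \<open>Elementary facts on the numerical range and the operator norm\<close>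

lemma norm_le_numerical_radius:
  fixes T :: "complex^2^2"
  assumes "z \<in> numerical_range T"
  shows "cmod z \<le> numerical_radius T"
proof -
  have "bdd_above (cmod ` numerical_range T)"
  proof (rule bdd_aboveI2)
    fix z assume "z \<in> numerical_range T"
    then obtain x where z: "z = hinner (T *v x) x" and "norm x = 1" by (auto simp: numerical_range_def)
    have x: "cmod (x $ i) \<le> 1" for i using Finite_Cartesian_Product.norm_nth_le[of x i] \<open>norm x = 1\<close> by simp
    have bound: "cmod (e * (x $ j * cnj (x $ i))) \<le> cmod e" for e i j
      using mult_left_le[OF mult_le_one[OF x _ x, of i j], of "cmod e"] by (simp add: norm_mult mult.commute)
    show "cmod z \<le> cmod (T$1$1) + cmod (T$1$2) + cmod (T$2$1) + cmod (T$2$2)"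
      unfolding z hinner_2 by (intro norm_triangle_mono bound)
  qed
  then show ?thesis unfolding numerical_radius_def using assms by (intro cSUP_upper)
qed

lemma numerical_radius_le:
  fixes T :: "complex^2^2"
  assumes "\<And>z. z \<in> numerical_range T \<Longrightarrow> cmod z \<le> r"
  shows "numerical_radius T \<le> r"
proof -
  have "hinner (T *v axis 1 1) (axis 1 1) \<in> numerical_range T"
    unfolding numerical_range_def by (auto simp: norm_axis_1)
  then show ?thesis unfolding numerical_radius_def using assms by (intro cSUP_least) auto
qed

lemma diagonal_in_numerical_range:
  fixes T :: "complex^2^2"
  shows "T $ i $ i \<in> numerical_range T"
proof -
  have "hinner (T *v axis i 1) (axis i 1) = T $ i $ i"
    using exhaust_2[of i] by (auto simp: hinner_2 axis_def)
  moreover have "norm (axis i 1 :: complex^2) = 1" by (simp add: norm_axis_1)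
  ultimately show ?thesis unfolding numerical_range_def by (intro CollectI exI[of _ "axis i 1"]) simp
qed

lemma trace_le_of_numerical_range:
  fixes T :: "complex^2^2"
  assumes "\<And>z. z \<in> numerical_range T \<Longrightarrow> cmod z \<le> r"
  shows "cmod (trace T) \<le> 2 * r"
  using assms[OF diagonal_in_numerical_range[of T 1]] assms[OF diagonal_in_numerical_range[of T 2]]
    norm_triangle_ineq[of "T$1$1" "T$2$2"] by (simp add: trace_2)

lemma hinner_scaleR_left: "hinner ((c *\<^sub>R T) *v x) x = c *\<^sub>R hinner (T *v x) x" for T :: "complex^2^2"
  by (simp add: hinner_2 scaleR_right_distrib)

lemma numerical_range_scaleR:
  "numerical_range (c *\<^sub>R T) = (\<lambda>z. c *\<^sub>R z) ` numerical_range T" for T :: "complex^2^2"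
  by (auto simp: numerical_range_def hinner_scaleR_left)

lemma numerical_radius_scaleR:
  fixes T :: "complex^2^2"
  assumes "0 < c"
  shows "numerical_radius (c *\<^sub>R T) = c * numerical_radius T"
proof (rule antisym)
  show "numerical_radius (c *\<^sub>R T) \<le> c * numerical_radius T"
    using assms norm_le_numerical_radius[of _ T]
    by (intro numerical_radius_le) (auto simp: numerical_range_scaleR)
  have "numerical_radius T \<le> numerical_radius (c *\<^sub>R T) / c"
  proof (rule numerical_radius_le)
    fix z assume "z \<in> numerical_range T"
    then have "cmod (c *\<^sub>R z) \<le> numerical_radius (c *\<^sub>R T)"
      by (intro norm_le_numerical_radius) (auto simp: numerical_range_scaleR)
    then show "cmod z \<le> numerical_radius (c *\<^sub>R T) / c" using assms by (simp add: field_simps)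
  qed
  then show "c * numerical_radius T \<le> numerical_radius (c *\<^sub>R T)" using assms by (simp add: field_simps)
qed

lemma op_norm_scaleR: "op_norm (c *\<^sub>R T) = \<bar>c\<bar> * op_norm T"
proof -
  have "(\<lambda>x. (c *\<^sub>R T) *v x) = (\<lambda>x. c *\<^sub>R (T *v x))"
    by (simp add: fun_eq_iff vec_eq_iff matrix_vector_mult_def scaleR_sum_right)
  then show ?thesis unfolding op_norm_def by (simp add: onorm_scaleR)
qed

lemma op_norm_pos:
  assumes "T \<noteq> 0"
  shows "0 < op_norm T"
proof -
  have "\<exists>x. T *v x \<noteq> 0" using assms matrix_eq[of T 0] by auto
  then show ?thesis unfolding op_norm_def by (subst onorm_pos_lt) auto
qed

lemma sector_scaleR:
  assumes "0 < c" "z \<in> sector \<alpha>"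
  shows "c *\<^sub>R z \<in> sector \<alpha>"
  using assms by (auto simp: sector_def abs_mult mult.assoc split: if_splits)

text \<open>The matrix \<open>1 - T* T\<close> is positive semidefinite and, since the norm is attained on the compact
  unit sphere, singular. So its determinant \<open>1 - frobenius_sq T + (cmod (det T))\<^sup>2\<close> vanishes.\<close>
lemma frobenius_sq_of_op_norm_1:
  fixes T :: "complex^2^2"
  assumes "op_norm T = 1"
  shows "frobenius_sq T = 1 + (cmod (det T))\<^sup>2" and "cmod (det T) \<le> 1"
proof -
  define a b c d where "a = T$1$1" "b = T$1$2" "c = T$2$1" "d = T$2$2"
  define p where "p = 1 - (cmod a)\<^sup>2 - (cmod c)\<^sup>2"
  define u where "u = 1 - (cmod b)\<^sup>2 - (cmod d)\<^sup>2"
  define g where "g = 2 * (cnj a * b + cnj c * d)"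
  \<comment> \<open>\<open>h\<close> is the quadratic form of \<open>1 - T* T\<close>, with diagonal entries \<open>p\<close>, \<open>u\<close>.\<close>
  define h where "h x y = p * (cmod x)\<^sup>2 + u * (cmod y)\<^sup>2 - Re (g * (y * cnj x))" for x y
  have h: "h (x $ 1) (x $ 2) = (norm x)\<^sup>2 - (norm (T *v x))\<^sup>2" for x :: "complex^2"
  proof -
    have "(T *v x) $ 1 = a * x $ 1 + b * x $ 2" "(T *v x) $ 2 = c * x $ 1 + d * x $ 2"
      by (simp_all add: a_b_c_d_def matrix_vector_mult_def UNIV_2)
    then show ?thesis
      unfolding norm_sq_2 h_def p_def u_def g_def cmod_power2
      by (simp add: power2_eq_square algebra_simps)
  qed
  have le: "norm (T *v x) \<le> norm x" for x
    using onorm[OF matrix_vector_mul_bounded_linear, of T x] assms by (simp add: op_norm_def)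
  have nonneg: "0 \<le> h x y" for x y
    using h[of "vector [x, y]"] le[of "vector [x, y]"] by (simp add: power_mono)
  then have "(cmod g)\<^sup>2 \<le> 4 * p * u"
    unfolding h_def by (rule hermitian_form_nonneg)
  moreover have "4 * p * u \<le> (cmod g)\<^sup>2"
  proof (rule ccontr)
    assume less: "\<not> 4 * p * u \<le> (cmod g)\<^sup>2"
    have "\<exists>x\<in>sphere 0 1. \<forall>y\<in>sphere 0 1. norm (T *v y) \<le> norm (T *v x)"
    proof (rule continuous_attains_sup)
      show "sphere 0 1 \<noteq> ({} :: (complex^2) set)" by simp
      show "continuous_on (sphere 0 1) (\<lambda>x. norm (T *v x))"
        by (intro continuous_on_norm linear_continuous_on matrix_vector_mul_bounded_linear)
    qed simp
    then obtain x where x: "norm x = 1" "\<And>y. norm y = 1 \<Longrightarrow> norm (T *v y) \<le> norm (T *v x)" by auto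
    have "op_norm T \<le> norm (T *v x)"
      unfolding op_norm_def
    proof (rule onorm_bound)
      fix y
      show "norm (T *v y) \<le> norm (T *v x) * norm y"
      proof (cases "y = 0")
        case False
        have "norm (T *v ((1 / norm y) *\<^sub>R y)) \<le> norm (T *v x)" using False by (intro x) simp
        then show ?thesis
          using False by (simp add: linear_scale[OF matrix_vector_mul_linear] divide_le_eq)
      qed simp
    qed simp
    with assms x le[of x] have "h (x$1) (x$2) = 0" by (simp add: h)
    \<comment> \<open>Completing the square: a definite form cannot vanish at the maximising unit vector \<open>x\<close>.\<close>
    have square: "4 * p * h (x$1) (x$2) = (cmod (2 * p * x$1 - g * x$2))\<^sup>2 + (4 * p * u - (cmod g)\<^sup>2) * (cmod (x$2))\<^sup>2"
      unfolding h_def cmod_power2 by (simp add: power2_eq_square algebra_simps)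
    have "0 \<le> (4 * p * u - (cmod g)\<^sup>2) * (cmod (x$2))\<^sup>2" using less by (intro mult_nonneg_nonneg) auto
    then have "(4 * p * u - (cmod g)\<^sup>2) * (cmod (x$2))\<^sup>2 = 0"
      using square[unfolded \<open>h (x$1) (x$2) = 0\<close>] zero_le_power2[of "cmod (2 * p * x$1 - g * x$2)"] by linarith
    then have "x$2 = 0" using less by auto
    moreover have "p \<noteq> 0" using less by auto
    ultimately have "x$1 = 0" using \<open>h (x$1) (x$2) = 0\<close> by (simp add: h_def)
    with \<open>x$2 = 0\<close> \<open>norm x = 1\<close> norm_sq_2[of x] show False by simp
  qed
  moreover have "4 * p * u - (cmod g)\<^sup>2 = 4 * (1 - frobenius_sq T + (cmod (det T))\<^sup>2)"
  proof -
    have "(cmod g)\<^sup>2 = 4 * ((cmod a)\<^sup>2 * (cmod b)\<^sup>2 + (cmod c)\<^sup>2 * (cmod d)\<^sup>2 + 2 * Re (cnj a * b * c * cnj d))"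
      unfolding g_def cmod_power2 by (simp add: power2_eq_square algebra_simps)
    moreover have "(cmod (a * d - b * c))\<^sup>2
        = (cmod a)\<^sup>2 * (cmod d)\<^sup>2 + (cmod b)\<^sup>2 * (cmod c)\<^sup>2 - 2 * Re (cnj a * b * c * cnj d)"
      unfolding cmod_power2 by (simp add: power2_eq_square algebra_simps)
    ultimately show ?thesis
      unfolding p_def u_def frobenius_sq_2 det_2 a_b_c_d_def[symmetric] by algebra
  qed
  ultimately have "4 * (1 - frobenius_sq T + (cmod (det T))\<^sup>2) = 0" by (simp only: order_antisym)
  then show F: "frobenius_sq T = 1 + (cmod (det T))\<^sup>2" by simp
  have "0 \<le> h 1 0" "0 \<le> h 0 1" using nonneg by auto
  then have "frobenius_sq T \<le> 2"
    by (simp add: h_def p_def u_def frobenius_sq_2 flip: a_b_c_d_def)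
  with F show "cmod (det T) \<le> 1" by (simp add: power_le_one_iff)
qed

section \<open>The real optimisation problem\<close>

text \<open>The real inequality behind the theorem, for \<open>t\<close> and \<open>q\<close> the moduli of determinant and trace of
  a matrix of norm one, and \<open>W\<close> the claimed least numerical radius. The left side of \<open>radius\<close> is
  quadratic in \<open>k\<close> with minimum at \<open>k = W * q / (2 * t)\<close>. If this is less than \<open>1\<close>, the minimum gives
  \<open>(1 - t)\<^sup>2 \<le> Q * (1 - t - t * s)\<close> for \<open>Q = (1 + t)\<^sup>2 - q\<^sup>2\<close>; as \<open>sector\<close> says \<open>Q \<le> 4 * t * s\<close>, the
  square of \<open>1 - t - 2 * t * s\<close> is at most \<open>0\<close>, and every inequality used is an equality.
  Otherwise \<open>k = 1\<close> gives \<open>q + (1 - t) \<le> 2 * W\<close>, which together with \<open>sector\<close> bounds \<open>1 - t\<close> from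
  both sides by incompatible numbers.\<close>
lemma extremal_parameters:
  fixes s t q W :: real
  assumes s: "0 < s" "s \<le> 1" and t: "0 \<le> t" "t \<le> 1" and q: "0 \<le> q" "q \<le> 2 * W"
    and W: "0 < W" "W\<^sup>2 * (1 + s) = 1"
    and sector: "(1 + t)\<^sup>2 - 4 * t * s \<le> q\<^sup>2"
    and radius: "\<And>k. 0 \<le> k \<Longrightarrow> k \<le> 1 \<Longrightarrow> 4 * W\<^sup>2 - 4 * W * q * k + q\<^sup>2 + 2 * t * (2 * k\<^sup>2 - 1) - (1 + t\<^sup>2) \<ge> 0"
  shows "t * (1 + 2 * s) = 1" "q\<^sup>2 = (1 + t)\<^sup>2 - 4 * t * s"
    "W * q < 2 * t"
    "4 * W\<^sup>2 - 4 * W * q * (W * q / (2 * t)) + q\<^sup>2 + 2 * t * (2 * (W * q / (2 * t))\<^sup>2 - 1) - (1 + t\<^sup>2) = 0"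
proof -
  define m where "m = 1 - t"
  have "W < 1"
  proof (rule ccontr)
    assume "\<not> W < 1"
    then have "1 \<le> W\<^sup>2" by (simp add: one_le_power)
    then have "1 * (1 + s) \<le> W\<^sup>2 * (1 + s)" using s by (intro mult_right_mono) auto
    with W s show False by simp
  qed
  have "m\<^sup>2 \<le> (2 * W - q)\<^sup>2"
    using radius[of 1] by (simp add: m_def power2_eq_square algebra_simps)
  then have qm: "q + m \<le> 2 * W"
    using q t power2_le_imp_le[of m "2 * W - q"] by (simp add: m_def)
  \<comment> \<open>The minimiser lies in the unit interval.\<close>
  show Wq: "W * q < 2 * t"
  proof (rule ccontr)
    assume "\<not> W * q < 2 * t"
    then have "2 * t \<le> W * q" by simp
    also have "\<dots> \<le> W * (2 * W - m)" using qm W by (intro mult_left_mono) auto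
    finally have "2 * (1 - W\<^sup>2) \<le> m * (2 - W)" by (simp add: m_def power2_eq_square algebra_simps)
    moreover have "1 - W\<^sup>2 = s * W\<^sup>2" using W by (simp add: algebra_simps)
    ultimately have lower: "2 * s * W\<^sup>2 \<le> m * (2 - W)" by simp
    have "q\<^sup>2 \<le> (2 * W - m)\<^sup>2" using qm q by (intro power_mono) auto
    with sector have "m * (W - 1 + s) \<le> W\<^sup>2 - 1 + s"
      by (simp add: m_def power2_eq_square algebra_simps)
    also have "W\<^sup>2 - 1 + s = s\<^sup>2 * W\<^sup>2" using W by algebra
    finally have upper: "m * (W - 1 + s) \<le> s\<^sup>2 * W\<^sup>2" .
    \<comment> \<open>This makes the lower and upper bounds for \<open>m\<close> incompatible.\<close>
    have "(2 * W)\<^sup>2 * (1 + s) < (W * (2 + s))\<^sup>2"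
      using W s by (simp add: power2_eq_square algebra_simps)
    moreover have "(2 * W)\<^sup>2 * (1 + s) = 2\<^sup>2" using W by (simp add: power_mult_distrib)
    ultimately have "2 < W * (2 + s)"
      using power2_less_imp_less[of 2 "W * (2 + s)"] W s by simp
    moreover have "0 < m"
    proof -
      have "0 < 2 * s * W\<^sup>2" using W s by simp
      then have "0 < m * (2 - W)" using lower by linarith
      then show ?thesis using \<open>W < 1\<close> by (simp add: zero_less_mult_iff)
    qed
    ultimately have "m * (s * (2 - W)) < m * (2 * (W - 1 + s))"
      by (intro mult_strict_left_mono) (auto simp: algebra_simps)
    also have "\<dots> \<le> s * (2 * s * W\<^sup>2)"
      using mult_left_mono[OF upper, of 2] by (simp add: power2_eq_square mult_ac)
    also have "\<dots> \<le> s * (m * (2 - W))" using lower s by (intro mult_left_mono) auto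
    finally show False by (simp add: algebra_simps)
  qed
  then have "0 < t" using mult_nonneg_nonneg[of W q] W q by linarith
  define k where "k = W * q / (2 * t)"
  define Q where "Q = (1 + t)\<^sup>2 - q\<^sup>2"
  have k: "0 \<le> k" "k \<le> 1" "2 * t * k = W * q" using Wq \<open>0 < t\<close> W q by (auto simp: k_def)
  have at_k: "t * (4 * W\<^sup>2 - 4 * W * q * k + q\<^sup>2 + 2 * t * (2 * k\<^sup>2 - 1) - (1 + t\<^sup>2))
      = W\<^sup>2 * (Q - m\<^sup>2) - t * Q"
    unfolding Q_def m_def using k(3) by algebra
  have "W\<^sup>2 * (Q - m\<^sup>2) - t * Q \<ge> 0"
    using radius[OF k(1,2)] \<open>0 < t\<close> by (simp flip: at_k)
  then have "(1 + s) * (W\<^sup>2 * (Q - m\<^sup>2) - t * Q) \<ge> 0" using s by simp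
  moreover have mult: "(1 + s) * (W\<^sup>2 * (Q - m\<^sup>2) - t * Q) = Q * (1 - t - t * s) - m\<^sup>2"
    using W by algebra
  ultimately have main: "m\<^sup>2 \<le> Q * (1 - t - t * s)" by simp
  have "q < 1 + t" using qm \<open>W < 1\<close> by (simp add: m_def)
  then have "Q > 0" using q by (simp add: Q_def power_strict_mono)
  then have "0 \<le> 1 - t - t * s"
    using order_trans[OF zero_le_power2 main] by (simp add: zero_le_mult_iff)
  then have "Q * (1 - t - t * s) \<le> 4 * t * s * (1 - t - t * s)"
    using sector by (intro mult_right_mono) (auto simp: Q_def)
  with main have "(1 - t - 2 * t * s)\<^sup>2 \<le> 0"
    by (simp add: m_def power2_eq_square algebra_simps)
  then have eq: "1 - t - 2 * t * s = 0" by simp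
  then show "t * (1 + 2 * s) = 1" by (simp add: algebra_simps)
  have "1 - t - t * s = t * s" "m = 2 * (t * s)" using eq by (auto simp: m_def)
  with main have "(4 * (t * s)) * (t * s) \<le> Q * (t * s)" by (simp add: power2_eq_square)
  then have "4 * (t * s) \<le> Q" using s \<open>0 < t\<close> by (simp add: mult_le_cancel_right)
  with sector have Q: "Q = 4 * t * s" by (simp add: Q_def)
  then show "q\<^sup>2 = (1 + t)\<^sup>2 - 4 * t * s" by (simp add: Q_def)
  have "Q * (1 - t - t * s) - m\<^sup>2 = 0" using Q eq unfolding m_def by algebra
  then have "W\<^sup>2 * (Q - m\<^sup>2) - t * Q = 0" using mult s by simp
  then show "4 * W\<^sup>2 - 4 * W * q * (W * q / (2 * t)) + q\<^sup>2 + 2 * t * (2 * (W * q / (2 * t))\<^sup>2 - 1) - (1 + t\<^sup>2) = 0"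
    using at_k \<open>0 < t\<close> unfolding k_def by simp
qed

section \<open>Unitary similarity and the Schur form\<close>

lemma mat2_eq_iff: "A = B \<longleftrightarrow> A$1$1 = B$1$1 \<and> A$1$2 = B$1$2 \<and> A$2$1 = B$2$1 \<and> A$2$2 = B$2$2"
  for A B :: "'a^2^2"
  by (auto simp: vec_eq_iff forall_2)

lemma conj_transpose_mult: "conj_transpose (A ** B) = conj_transpose B ** conj_transpose A"
  by (simp add: conj_transpose_def matrix_matrix_mult_def vec_eq_iff mult.commute)

lemma conj_transpose_conj_transpose: "conj_transpose (conj_transpose A) = A"
  by (simp add: conj_transpose_def vec_eq_iff)

lemma frobenius_sq_eq_trace: "of_real (frobenius_sq T) = trace (T ** conj_transpose T)"
  unfolding frobenius_sq_def trace_def matrix_matrix_mult_def conj_transpose_def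
  by (simp add: complex_mult_cnj cmod_power2)

lemma frobenius_sq_unitary:
  assumes "unitary_matrix U"
  shows "frobenius_sq (conj_transpose U ** B ** U) = frobenius_sq B"
proof -
  let ?U = "conj_transpose U"
  have U: "U ** ?U = mat 1" using assms by (simp add: unitary_matrix_def)
  have "trace ((?U ** B ** U) ** conj_transpose (?U ** B ** U))
      = trace ((?U ** B) ** ((U ** ?U) ** (conj_transpose B ** U)))"
    by (simp add: conj_transpose_mult conj_transpose_conj_transpose matrix_mul_assoc)
  also have "\<dots> = trace (?U ** (B ** conj_transpose B ** U))"
    by (simp add: U matrix_mul_assoc)
  also have "\<dots> = trace ((B ** conj_transpose B ** U) ** ?U)" by (rule trace_mul_sym)
  also have "\<dots> = trace (B ** conj_transpose B)"
    by (simp add: U flip: matrix_mul_assoc)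
  finally show ?thesis by (simp flip: frobenius_sq_eq_trace)
qed

text \<open>A nonzero vector orthogonal to the conjugate of a nonzero row of \<open>T - \<nu>\<close> is an eigenvector,
  since the rows of a singular matrix are proportional.\<close>
lemma eigenvector_2:
  fixes T :: "complex^2^2"
  assumes root: "\<nu>\<^sup>2 - trace T * \<nu> + det T = 0"
  obtains v where "norm v = 1" "T *v v = \<nu> *s v"
proof -
  have "\<exists>w. w \<noteq> 0 \<and> T *v w = \<nu> *s w"
  proof -
    define a b c d where "a = T$1$1" "b = T$1$2" "c = T$2$1" "d = T$2$2"
    have T: "T *v vector [x, y] = \<nu> *s vector [x, y] \<longleftrightarrow> a * x + b * y = \<nu> * x \<and> c * x + d * y = \<nu> * y" for x y
      by (auto simp: a_b_c_d_def vec_eq_iff forall_2 matrix_vector_mult_def UNIV_2)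
    have nz: "vector [x, y] \<noteq> (0 :: complex^2) \<longleftrightarrow> x \<noteq> 0 \<or> y \<noteq> 0" for x y
      by (auto simp: vec_eq_iff forall_2)
    have root': "(\<nu> - a) * (\<nu> - d) = b * c"
      using root by (simp add: trace_2 det_2 power2_eq_square algebra_simps flip: a_b_c_d_def)
    consider "b \<noteq> 0 \<or> \<nu> \<noteq> a" | "b = 0" "\<nu> = a" "\<nu> \<noteq> d \<or> c \<noteq> 0" | "b = 0" "\<nu> = a" "\<nu> = d" "c = 0"
      by blast
    then show ?thesis
    proof cases
      case 1
      have "T *v vector [b, \<nu> - a] = \<nu> *s vector [b, \<nu> - a]"
        unfolding T using root' by (auto simp: algebra_simps)
      with 1 show ?thesis using nz[of b "\<nu> - a"] by auto
    next
      case 2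
      have "T *v vector [\<nu> - d, c] = \<nu> *s vector [\<nu> - d, c]"
        unfolding T using 2 by (auto simp: algebra_simps)
      with 2 show ?thesis using nz[of "\<nu> - d" c] by auto
    next
      case 3
      then have "T *v vector [1, 0] = \<nu> *s vector [1, 0]" unfolding T by auto
      then show ?thesis using nz[of 1 0] by auto
    qed
  qed
  then obtain w where w: "w \<noteq> 0" "T *v w = \<nu> *s w" by blast
  show thesis
  proof
    show "norm ((1 / norm w) *\<^sub>R w) = 1" using w by simp
    show "T *v ((1 / norm w) *\<^sub>R w) = \<nu> *s ((1 / norm w) *\<^sub>R w)"
      unfolding linear_scale[OF matrix_vector_mul_linear] w by (simp add: vec_eq_iff)
  qed
qed

lemma unit_phase:
  obtains u where "cmod u = 1" "u * z = of_real (cmod z)"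
proof (cases "z = 0")
  case True
  then show thesis using that[of 1] by simp
next
  case False
  then show thesis
    using complex_norm_square[of z]
    by (intro that[of "cnj z / cmod z"]) (simp_all add: norm_divide divide_eq_eq mult.commute power2_eq_square)
qed

text \<open>The columns of the adjoint of \<open>U\<close> are a unit eigenvector \<open>(x, y)\<close> and the orthogonal vector
  \<open>w * (- cnj y, cnj x)\<close>, whose phase \<open>w\<close> makes the upper right entry nonnegative. That entry is
  then determined by the invariance of the Frobenius norm.\<close>
lemma schur_triangularisation:
  fixes T :: "complex^2^2"
  assumes root: "\<nu>\<^sup>2 - trace T * \<nu> + det T = 0"
  obtains \<kappa> where "0 \<le> \<kappa>" "\<kappa>\<^sup>2 = frobenius_sq T - (cmod \<nu>)\<^sup>2 - (cmod (trace T - \<nu>))\<^sup>2"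
    "unitarily_similar T (vector [vector [\<nu>, of_real \<kappa>], vector [0, trace T - \<nu>]])"
proof -
  obtain v where v: "norm v = 1" "T *v v = \<nu> *s v" by (rule eigenvector_2[OF root])
  define a b c d where "a = T$1$1" "b = T$1$2" "c = T$2$1" "d = T$2$2"
  define x y where "x = v$1" "y = v$2"
  define \<mu> where "\<mu> = trace T - \<nu>"
  have unit: "x * cnj x + y * cnj y = 1"
    using norm_sq_2[of v] v
    unfolding x_y_def complex_norm_square[symmetric] of_real_add[symmetric] of_real_power[symmetric] by simp
  have e1: "a * x + b * y = \<nu> * x" and e2: "c * x + d * y = \<nu> * y"
    using v(2) by (auto simp: x_y_def a_b_c_d_def vec_eq_iff forall_2 matrix_vector_mult_def UNIV_2)
  have \<mu>: "\<mu> = a + d - \<nu>" by (simp add: \<mu>_def trace_2 a_b_c_d_def)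
  define \<kappa>' where "\<kappa>' = cnj x * (b * cnj x - a * cnj y) + cnj y * (d * cnj x - c * cnj y)"
  obtain w where w: "cmod w = 1" "w * \<kappa>' = of_real (cmod \<kappa>')" by (rule unit_phase)
  have ww: "w * cnj w = 1" using w complex_norm_square[of w] by simp
  have \<kappa>': "cnj w * of_real (cmod \<kappa>') = \<kappa>'" unfolding w(2)[symmetric] using ww by algebra
  define U :: "complex^2^2" where
    "U = vector [vector [cnj x, cnj y], vector [- cnj w * y, cnj w * x]]"
  define B :: "complex^2^2" where "B = vector [vector [\<nu>, of_real (cmod \<kappa>')], vector [0, \<mu>]]"
  have U: "unitary_matrix U"
    unfolding unitary_matrix_def mat2_eq_iff
    using unit ww
    apply (simp add: U_def conj_transpose_def matrix_matrix_mult_def UNIV_2 mat_def)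
    apply (intro conjI; algebra)
    done
  have T: "T = conj_transpose U ** B ** U"
  proof -
    have 11: "a = x * \<nu> * cnj x + (x * of_real (cmod \<kappa>') - w * cnj y * \<mu>) * (- (cnj w * y))"
      using unit e1 e2 \<mu> ww \<kappa>' \<kappa>'_def by algebra
    have 12: "b = x * \<nu> * cnj y + (x * of_real (cmod \<kappa>') - w * cnj y * \<mu>) * (cnj w * x)"
      using unit e1 e2 \<mu> ww \<kappa>' \<kappa>'_def by algebra
    have 21: "c = y * \<nu> * cnj x + (y * of_real (cmod \<kappa>') + w * cnj x * \<mu>) * (- (cnj w * y))"
      using unit e1 e2 \<mu> ww \<kappa>' \<kappa>'_def by algebra
    have 22: "d = y * \<nu> * cnj y + (y * of_real (cmod \<kappa>') + w * cnj x * \<mu>) * (cnj w * x)"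
      using unit e1 e2 \<mu> ww \<kappa>' \<kappa>'_def by algebra
    show ?thesis
      using 11 12 21 22 unfolding mat2_eq_iff
      by (simp add: U_def B_def conj_transpose_def matrix_matrix_mult_def UNIV_2 flip: a_b_c_d_def)
  qed
  show thesis
  proof
    show "0 \<le> cmod \<kappa>'" by simp
    show "unitarily_similar T (vector [vector [\<nu>, of_real (cmod \<kappa>')], vector [0, trace T - \<nu>]])"
      using U T by (auto simp: unitarily_similar_def B_def \<mu>_def)
    have "frobenius_sq T = frobenius_sq B" unfolding T by (rule frobenius_sq_unitary[OF U])
    also have "\<dots> = (cmod \<nu>)\<^sup>2 + (cmod \<kappa>')\<^sup>2 + (cmod (trace T - \<nu>))\<^sup>2"
      by (simp add: frobenius_sq_2 B_def \<mu>_def)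
    finally show "(cmod \<kappa>')\<^sup>2 = frobenius_sq T - (cmod \<nu>)\<^sup>2 - (cmod (trace T - \<nu>))\<^sup>2"
      by linarith
  qed
qed

text \<open>Trace, determinant and Frobenius norm determine a \<open>2 \<times> 2\<close> matrix up to unitary similarity:
  the first two give the eigenvalues, and the third gives the off-diagonal entry of the Schur form.
  The hypotheses are the values of these invariants at \<open>extremal_matrix s\<close>, where \<open>t = 1 / (1 + 2 * s)\<close>.\<close>
lemma unitarily_similar_extremal:
  fixes T :: "complex^2^2"
  assumes s: "0 \<le> s" "s \<le> 1" and t: "t * (1 + 2 * s) = 1"
    and T: "det T = of_real t" "trace T = of_real q" "0 \<le> q" "q\<^sup>2 = (1 + t)\<^sup>2 - 4 * t * s"
      "frobenius_sq T = 1 + t\<^sup>2"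
  shows "unitarily_similar T (extremal_matrix s)"
proof -
  define A where "A = sqrt (1 + s - s\<^sup>2)"
  define L where "L = sqrt (s + s\<^sup>2)"
  have "s\<^sup>2 \<le> s" using s by (simp add: power2_eq_square mult_left_le)
  then have A: "A\<^sup>2 = 1 + s - s\<^sup>2" "0 \<le> A" using s by (auto simp: A_def)
  have L: "L\<^sup>2 = s + s\<^sup>2" using s by (auto simp: L_def)
  have "0 < t" using t s by (metis add_nonneg_nonneg mult_nonneg_nonneg zero_le_numeral zero_less_one zero_less_mult_pos2 add_pos_nonneg)
  have "q\<^sup>2 = (2 * t * A)\<^sup>2" using T(4) A t by algebra
  then have q: "q = 2 * t * A" using T(3) A \<open>0 < t\<close> by (simp add: power2_eq_iff_nonneg)
  \<comment> \<open>The eigenvalue of positive imaginary part comes first, as in the extremal matrix.\<close>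
  define \<nu> where "\<nu> = Complex (t * A) (t * L)"
  have norm: "(t * A)\<^sup>2 + (t * L)\<^sup>2 = t" using A L t by algebra
  have root: "\<nu>\<^sup>2 - trace T * \<nu> + det T = 0"
    using norm by (simp add: T \<nu>_def q complex_eq_iff power2_eq_square algebra_simps)
  obtain \<kappa> where \<kappa>: "0 \<le> \<kappa>" "\<kappa>\<^sup>2 = frobenius_sq T - (cmod \<nu>)\<^sup>2 - (cmod (trace T - \<nu>))\<^sup>2"
    "unitarily_similar T (vector [vector [\<nu>, of_real \<kappa>], vector [0, trace T - \<nu>]])"
    by (rule schur_triangularisation[OF root])
  have tr: "trace T - \<nu> = Complex (t * A) (- (t * L))"
    by (simp add: T q \<nu>_def complex_eq_iff)
  have "\<kappa>\<^sup>2 = 1 + t\<^sup>2 - t - t"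
    using \<kappa>(2) norm unfolding tr by (simp add: T cmod_power2 \<nu>_def)
  also have "\<dots> = (2 * s * t)\<^sup>2" using t by algebra
  finally have "\<kappa> = 2 * s * t" using \<kappa>(1) s \<open>0 < t\<close> by (simp add: power2_eq_iff_nonneg)
  moreover have "1 / (1 + 2 * s) = t" using t s by (simp add: divide_eq_eq)
  ultimately have "vector [vector [\<nu>, of_real \<kappa>], vector [0, trace T - \<nu>]] = extremal_matrix s"
    unfolding tr by (simp add: extremal_matrix_def mat2_eq_iff \<nu>_def complex_eq_iff A_def L_def)
  with \<kappa>(3) show ?thesis by simp
qed

section \<open>The numerical range of the extremal matrix\<close>

lemma hinner_conj_transpose: "hinner (conj_transpose U *v y) x = hinner y (U *v x)"
proof -
  have "hinner (conj_transpose U *v y) x = (\<Sum>i\<in>UNIV. \<Sum>j\<in>UNIV. cnj (U$j$i) * y$j * cnj (x$i))"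
    by (simp add: hinner_def conj_transpose_def matrix_vector_mult_def sum_distrib_right)
  also have "\<dots> = (\<Sum>j\<in>UNIV. \<Sum>i\<in>UNIV. cnj (U$j$i) * y$j * cnj (x$i))" by (rule sum.swap)
  also have "\<dots> = hinner y (U *v x)"
    by (simp add: hinner_def matrix_vector_mult_def sum_distrib_left mult_ac)
  finally show ?thesis .
qed

lemma hinner_self: "hinner x x = of_real ((norm x)\<^sup>2)"
  by (simp add: hinner_def norm_vec_def L2_set_def sum_nonneg complex_mult_cnj flip: cmod_power2)

lemma numerical_range_unitarily_similar:
  assumes "unitarily_similar A B"
  shows "numerical_range A \<subseteq> numerical_range B"
proof
  fix z assume "z \<in> numerical_range A"
  then obtain x where x: "z = hinner (A *v x) x" "norm x = 1" by (auto simp: numerical_range_def)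
  obtain U where U: "unitary_matrix U" and A: "A = conj_transpose U ** B ** U"
    using assms by (auto simp: unitarily_similar_def)
  have "of_real ((norm (U *v x))\<^sup>2) = hinner (conj_transpose U *v (U *v x)) x"
    by (simp add: hinner_conj_transpose hinner_self)
  also have "\<dots> = of_real ((norm x)\<^sup>2)"
    using U by (simp add: matrix_vector_mul_assoc unitary_matrix_def hinner_self)
  finally have "norm (U *v x) = 1" using x(2)
    by (metis norm_ge_zero of_real_eq_iff power2_eq_iff_nonneg zero_le_one)
  moreover have "z = hinner (B *v (U *v x)) (U *v x)"
    unfolding x(1) A by (simp add: hinner_conj_transpose flip: matrix_vector_mul_assoc)
  ultimately show "z \<in> numerical_range B" by (auto simp: numerical_range_def)
qed

text \<open>By the elliptical range theorem the numerical range is the ellipse with foci at the two eigenvalues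
  and minor axis \<open>2 * s / (1 + 2 * s)\<close>. It is parametrised by the point \<open>(P, 2 * Re v, 2 * Im v)\<close> of the
  unit sphere; the ordinate is estimated by the Cauchy-Schwarz inequality, and what remains is a
  quadratic in \<open>Re v\<close>.\<close>
lemma numerical_range_extremal:
  assumes s: "0 \<le> s" "s \<le> 1" and z: "z \<in> numerical_range (extremal_matrix s)"
  shows "(cmod z)\<^sup>2 * (1 + s) \<le> 1"
proof -
  obtain x where x: "z = hinner (extremal_matrix s *v x) x" "norm x = 1"
    using z by (auto simp: numerical_range_def)
  define A where "A = sqrt (1 + s - s\<^sup>2)"
  define L where "L = sqrt (s + s\<^sup>2)"
  have "s\<^sup>2 \<le> s" using s by (simp add: power2_eq_square mult_left_le)
  then have A: "A\<^sup>2 = 1 + s - s\<^sup>2" using s by (auto simp: A_def)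
  have L: "L\<^sup>2 = s + s\<^sup>2" using s by (auto simp: L_def)
  define v where "v = x$2 * cnj (x$1)"
  define P where "P = (cmod (x$1))\<^sup>2 - (cmod (x$2))\<^sup>2"
  have unit: "(cmod (x$1))\<^sup>2 + (cmod (x$2))\<^sup>2 = 1" using norm_sq_2[of x] x by simp
  have "(cmod v)\<^sup>2 = (cmod (x$1))\<^sup>2 * (cmod (x$2))\<^sup>2" by (simp add: v_def norm_mult power_mult_distrib)
  then have sphere: "P\<^sup>2 + 4 * ((Re v)\<^sup>2 + (Im v)\<^sup>2) = 1"
    using unit unfolding P_def cmod_power2[symmetric] by algebra
  have "z = (1 / (1 + 2 * s)) *\<^sub>R (Complex A L * (x$1 * cnj (x$1)) + of_real (2 * s) * v + Complex A (-L) * (x$2 * cnj (x$2)))"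
    unfolding x(1) hinner_2 extremal_matrix_def A_def[symmetric] L_def[symmetric] v_def
    by (simp only: vector_scaleR_component vector_2 mult_scaleR_left scaleR_add_right) simp
  then have "(1 + 2 * s) *\<^sub>R z = Complex A L * (x$1 * cnj (x$1)) + of_real (2 * s) * v + Complex A (-L) * (x$2 * cnj (x$2))"
    using s by simp
  also have "\<dots> = Complex (A * ((cmod (x$1))\<^sup>2 + (cmod (x$2))\<^sup>2) + 2 * s * Re v) (L * P + 2 * s * Im v)"
    unfolding complex_norm_square[symmetric] P_def by (simp add: complex_eq_iff algebra_simps)
  finally have z: "(1 + 2 * s) *\<^sub>R z = Complex (A + 2 * s * Re v) (L * P + 2 * s * Im v)"
    by (simp add: unit)
  have "(1 + 2 * s)\<^sup>2 * (cmod z)\<^sup>2 = (cmod ((1 + 2 * s) *\<^sub>R z))\<^sup>2" using s by (simp add: power_mult_distrib)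
  also have "\<dots> = (A + 2 * s * Re v)\<^sup>2 + (L * P + 2 * s * Im v)\<^sup>2" unfolding z by (simp add: cmod_power2)
  \<comment> \<open>Lagrange's identity for the vectors \<open>(L, s)\<close> and \<open>(P, 2 * Im v)\<close>.\<close>
  also have "(L * P + 2 * s * Im v)\<^sup>2 = (L\<^sup>2 + s\<^sup>2) * (P\<^sup>2 + 4 * (Im v)\<^sup>2) - (2 * L * Im v - s * P)\<^sup>2" by algebra
  also have "\<dots> \<le> (L\<^sup>2 + s\<^sup>2) * (P\<^sup>2 + 4 * (Im v)\<^sup>2)" by simp
  finally have "(1 + 2 * s)\<^sup>2 * (cmod z)\<^sup>2 \<le> (A + 2 * s * Re v)\<^sup>2 + (L\<^sup>2 + s\<^sup>2) * (P\<^sup>2 + 4 * (Im v)\<^sup>2)" by simp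
  then have "(1 + s) * ((1 + 2 * s)\<^sup>2 * (cmod z)\<^sup>2)
      \<le> (1 + s) * ((A + 2 * s * Re v)\<^sup>2 + (L\<^sup>2 + s\<^sup>2) * (P\<^sup>2 + 4 * (Im v)\<^sup>2))"
    using s by (intro mult_left_mono) auto
  \<comment> \<open>The maximum over the ellipse is at \<open>Re v = A / (2 * (1 + s))\<close>.\<close>
  also have "\<dots> = (1 + 2 * s)\<^sup>2 - s * (2 * (1 + s) * Re v - A)\<^sup>2"
    using sphere A L by algebra
  also have "\<dots> \<le> (1 + 2 * s)\<^sup>2" using s by simp
  finally have "(1 + 2 * s)\<^sup>2 * ((cmod z)\<^sup>2 * (1 + s)) \<le> (1 + 2 * s)\<^sup>2 * 1" by (simp add: mult_ac)
  then show ?thesis using s by (subst (asm) mult_le_cancel_left_pos) auto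
qed

section \<open>The sharp inequality\<close>

text \<open>At the minimising \<open>k\<close> the disc inequality with radius \<open>W\<close> is an equality. The strict versions of the
  sector and disc inequalities then force the determinant to be positive and aligned with the
  square of the trace; so the trace is real, and positive because the sector lies in the right
  half-plane. A numerical radius below \<open>W\<close> would make the disc inequality false.\<close>
lemma extremal_case:
  fixes T :: "complex^2^2"
  assumes \<alpha>: "0 < \<alpha>" "\<alpha> \<le> pi/2"
    and T: "op_norm T = 1" "numerical_range T \<subseteq> sector \<alpha>"
    and W: "0 < W" "W\<^sup>2 * (1 + (sin \<alpha>)\<^sup>2) = 1" "numerical_radius T \<le> W"
  shows "numerical_radius T = W" and "unitarily_similar T (extremal_matrix ((sin \<alpha>)\<^sup>2))"
proof -
  define s where "s = (sin \<alpha>)\<^sup>2"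
  define t where "t = cmod (det T)"
  define q where "q = cmod (trace T)"
  define r where "r = numerical_radius T"
  have "0 < sin \<alpha>" using \<alpha> by (intro sin_gt_zero) auto
  then have s: "0 < s" "s \<le> 1" by (auto simp: s_def power_le_one)
  have W_s: "W\<^sup>2 * (1 + s) = 1" using W by (simp add: s_def)
  have F: "frobenius_sq T = 1 + t\<^sup>2" and t: "0 \<le> t" "t \<le> 1"
    using frobenius_sq_of_op_norm_1[OF T(1)] by (auto simp: t_def)
  have in_W: "cmod z \<le> r" if "z \<in> numerical_range T" for z
    using norm_le_numerical_radius[OF that] by (simp add: r_def)
  have "r \<le> W" using W by (simp add: r_def)
  have "0 \<le> r" using in_W[OF diagonal_in_numerical_range[of T 1]] order_trans[OF norm_ge_zero] by blast
  have q: "0 \<le> q" "q \<le> 2 * r" using trace_le_of_numerical_range[OF in_W] by (auto simp: q_def)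
  obtain u where u: "cmod u = 1" "u * trace T = of_real (cmod (trace T))" by (rule unit_phase)
  have disc: "0 \<le> 4 * R\<^sup>2 - 4 * R * q * k + q\<^sup>2 + 2 * t * (2 * k\<^sup>2 - 1) - (1 + t\<^sup>2)"
    and disc_strict: "0 < k \<Longrightarrow> u\<^sup>2 * det T \<noteq> of_real t \<Longrightarrow>
        0 < 4 * R\<^sup>2 - 4 * R * q * k + q\<^sup>2 + 2 * t * (2 * k\<^sup>2 - 1) - (1 + t\<^sup>2)"
    if "r \<le> R" "0 \<le> k" "k \<le> 1" for R k
    using disc_bounds_trace[of T R u k] u that \<open>0 \<le> r\<close> in_W order_trans
    unfolding F t_def q_def by (meson, meson)
  have sect: "0 \<le> q\<^sup>2 + 2 * t * (2 * s - 1) - (1 + t\<^sup>2)"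
    and sect_strict: "det T \<noteq> of_real t \<Longrightarrow> 0 < q\<^sup>2 + 2 * t * (2 * s - 1) - (1 + t\<^sup>2)"
    using sector_bounds_trace[OF \<alpha> T(2)] unfolding F t_def q_def s_def by auto
  define k where "k = W * q / (2 * t)"
  have sector: "(1 + t)\<^sup>2 - 4 * t * s \<le> q\<^sup>2"
    using sect by (simp add: power2_eq_square algebra_simps)
  have "q \<le> 2 * W" using q \<open>r \<le> W\<close> by simp
  note params = extremal_parameters[OF s t q(1) this W(1) W_s sector disc[OF \<open>r \<le> W\<close>], folded k_def]
  have "0 < t" using params(1) t by (cases "t = 0") auto
  have "q\<^sup>2 = 4 * t\<^sup>2 * (1 + s * (1 - s))" using params(1,2) by algebra
  moreover have "0 < 4 * t\<^sup>2 * (1 + s * (1 - s))"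
    using \<open>0 < t\<close> s by (intro mult_pos_pos) (auto intro: add_pos_nonneg)
  ultimately have "0 < q" using q by (cases "q = 0") auto
  have k: "0 < k" "k < 1" using \<open>0 < q\<close> \<open>0 < t\<close> W params(3) by (auto simp: k_def)
  have det: "det T = of_real t"
    using sect_strict params(2) by (fastforce simp: power2_eq_square algebra_simps)
  have "u\<^sup>2 * det T = of_real t"
    using disc_strict[of W k] \<open>r \<le> W\<close> k params(4) by fastforce
  then have "u\<^sup>2 = 1" using det \<open>0 < t\<close> by simp
  then have "u = 1 \<or> u = -1" by (simp add: power2_eq_1_iff)
  moreover have "u \<noteq> -1"
  proof
    assume "u = -1"
    then have "Re (trace T) = - q" using u(2) by (simp add: complex_eq_iff q_def)
    moreover have "0 \<le> Re (T $ i $ i)" for i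
      using rotated_sector_nonneg[OF \<alpha>, of "T $ i $ i" 0] diagonal_in_numerical_range[of T i] T(2) \<alpha> by auto
    ultimately show False using \<open>0 < q\<close> by (simp add: trace_2) (smt (verit))
  qed
  ultimately have tr: "trace T = of_real q" using u(2) by (simp add: q_def)
  show "unitarily_similar T (extremal_matrix ((sin \<alpha>)\<^sup>2))"
    unfolding s_def[symmetric]
    using s params(1,2) det tr q F by (intro unitarily_similar_extremal) auto
  show "numerical_radius T = W"
  proof (rule ccontr)
    assume "numerical_radius T \<noteq> W"
    then have "r < W" using \<open>r \<le> W\<close> by (simp add: r_def)
    have "0 \<le> (r - W) * (r + W - q * k)"
      using disc[of r k] params(4) k by (simp add: power2_eq_square algebra_simps)
    then have "r + W \<le> q * k" using \<open>r < W\<close> by (simp add: zero_le_mult_iff)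
    also have "\<dots> \<le> q" using k q by (simp add: mult_left_le)
    finally show False using q \<open>r < W\<close> by simp
  qed
qed

theorem theorem2p1:
  fixes \<alpha> :: real and T :: "complex ^ 2 ^ 2"
  assumes "0 < \<alpha>" and "\<alpha> \<le> pi / 2"
    and "T \<noteq> 0"
    and "numerical_range T \<subseteq> sector \<alpha>"
  shows "op_norm T \<le> numerical_radius T * sqrt (1 + (sin \<alpha>)\<^sup>2) \<and>
    (op_norm T = numerical_radius T * sqrt (1 + (sin \<alpha>)\<^sup>2) \<longleftrightarrow>
      unitarily_similar ((1 / op_norm T) *\<^sub>R T) (extremal_matrix ((sin \<alpha>)\<^sup>2)))"
proof -
  define N where "N = op_norm T"
  define A where "A = (1 / N) *\<^sub>R T"
  define s where "s = (sin \<alpha>)\<^sup>2"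
  define W where "W = 1 / sqrt (1 + s)"
  have "0 < N" using op_norm_pos[OF \<open>T \<noteq> 0\<close>] by (simp add: N_def)
  have "0 \<le> s" "s \<le> 1" by (auto simp: s_def abs_square_le_1)
  then have W: "0 < W" "W\<^sup>2 * (1 + s) = 1" by (auto simp: W_def power_divide)
  have A: "op_norm A = 1" "numerical_range A \<subseteq> sector \<alpha>"
    using \<open>0 < N\<close> assms(4) sector_scaleR[of "1 / N"]
    by (auto simp: A_def op_norm_scaleR numerical_range_scaleR N_def)
  have radius: "numerical_radius A = numerical_radius T / N"
    using \<open>0 < N\<close> by (simp add: A_def numerical_radius_scaleR)
  have le: "op_norm T \<le> numerical_radius T * sqrt (1 + s) \<longleftrightarrow> W \<le> numerical_radius A"
    and eq: "op_norm T = numerical_radius T * sqrt (1 + s) \<longleftrightarrow> numerical_radius A = W"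
    using \<open>0 < N\<close> \<open>0 \<le> s\<close> unfolding radius W_def N_def[symmetric] by (auto simp: field_simps)
  note main = extremal_case[OF assms(1,2) A W(1) W(2)[unfolded s_def]]
  have "W \<le> numerical_radius A" using main(1) by linarith
  moreover have "numerical_radius A = W \<longleftrightarrow> unitarily_similar A (extremal_matrix s)"
  proof
    assume "numerical_radius A = W"
    then show "unitarily_similar A (extremal_matrix s)" using main(2) by (simp add: s_def)
  next
    assume similar: "unitarily_similar A (extremal_matrix s)"
    have "numerical_radius A \<le> W"
    proof (rule numerical_radius_le)
      fix z assume "z \<in> numerical_range A"
      then have "(cmod z)\<^sup>2 * (1 + s) \<le> W\<^sup>2 * (1 + s)"
        using numerical_range_extremal[OF \<open>0 \<le> s\<close> \<open>s \<le> 1\<close>] numerical_range_unitarily_similar[OF similar] W(2) by auto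
      then have "(cmod z)\<^sup>2 \<le> W\<^sup>2" using \<open>0 \<le> s\<close> by (subst (asm) mult_le_cancel_right_pos) auto
      then show "cmod z \<le> W" using W(1) power2_le_imp_le by fastforce
    qed
    then show "numerical_radius A = W" by (rule main(1))
  qed
  ultimately show ?thesis
    using le eq unfolding s_def[symmetric] N_def[symmetric] A_def[symmetric] by simp
qed

end
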